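(* Let ${\bf Y}$, $d^\pi_Y$, $\xi$ satisfy axioms (1)–(4), and let $\mathcal P_K({\bf Y})$ be the projection complex defined below. There is $K_0$ such that for every $K\ge K_0$, $\mathcal P_K({\bf Y})$ is a quasi-tree, i.e. it is quasi-isometric to a simplicial tree.
   Context: Axioms: ${\bf Y}$ is a set, for each $Y\in{\bf Y}$, $d^\pi_Y:({\bf Y}\setminus\{Y\})^2\to[0,\infty)$, and $\xi>0$, with (1) $d^\pi_Y(X,Z)=d^\pi_Y(Z,X)$; (2) $d^\pi_Y(X,Z)+d^\pi_Y(Z,W)\ge d^\pi_Y(X,W)$; (3) for pairwise distinct $X,Y,Z$, $\min\{d^\pi_Y(X,Z),d^\pi_Z(X,Y)\}<\xi$; (4) for all $X,Z$ the set $\{Y:d^\pi_Y(X,Z)\ge\xi\}$ is finite. Let $\mathcal H(X,Z)$ be the set of pairs $(X',Z')$ such that either $d^\pi_X(X',Z')>2\xi$ and $d^\pi_Z(X',Z')>2\xi$; or $X'=X$ and $d^\pi_Z(X,Z')>2\xi$; or $Z'=Z$ and $d^\pi_X(X',Z)>2\xi$; or $(X',Z')=(X,Z)$. Define $d_Y(X,Z)=\inf_{(X',Z')\in\mathcal H(X,Z)}d^\pi_Y(X',Z')$ and ${\bf Y}_K(X,Z)=\{Y\in{\bf Y}\setminus\{X,Z\}:d_Y(X,Z)>K\}$. $\mathcal P_K({\bf Y})$ is the graph with vertex set ${\bf Y}$ in which distinct $X,Z$ are joined by an edge of length 1 iff ${\bf Y}_K(X,Z)=\emptyset$. *)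

theory Defs
  imports Complex_Main
begin

text \<open>dpi Y X Z stands for d^pi_Y(X,Z); it is only meaningful for X, Z in YY - {Y}.\<close>

definition proj_axioms :: "'a set \<Rightarrow> ('a \<Rightarrow> 'a \<Rightarrow> 'a \<Rightarrow> real) \<Rightarrow> real \<Rightarrow> bool" where
  "proj_axioms YY dpi xi \<longleftrightarrow>
     xi > 0 \<and>
     (\<forall>Y\<in>YY. \<forall>X\<in>YY - {Y}. \<forall>Z\<in>YY - {Y}. dpi Y X Z \<ge> 0) \<and>
     (\<forall>Y\<in>YY. \<forall>X\<in>YY - {Y}. \<forall>Z\<in>YY - {Y}. dpi Y X Z = dpi Y Z X) \<and>
     (\<forall>Y\<in>YY. \<forall>X\<in>YY - {Y}. \<forall>Z\<in>YY - {Y}. \<forall>W\<in>YY - {Y}.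
         dpi Y X Z + dpi Y Z W \<ge> dpi Y X W) \<and>
     (\<forall>X\<in>YY. \<forall>Y\<in>YY. \<forall>Z\<in>YY. X \<noteq> Y \<and> Y \<noteq> Z \<and> X \<noteq> Z \<longrightarrow>
         min (dpi Y X Z) (dpi Z X Y) < xi) \<and>
     (\<forall>X\<in>YY. \<forall>Z\<in>YY. finite {Y\<in>YY - {X, Z}. dpi Y X Z \<ge> xi})"

definition HH :: "'a set \<Rightarrow> ('a \<Rightarrow> 'a \<Rightarrow> 'a \<Rightarrow> real) \<Rightarrow> real \<Rightarrow> 'a \<Rightarrow> 'a \<Rightarrow> ('a \<times> 'a) set" where
  "HH YY dpi xi X Z = {(X', Z'). X' \<in> YY \<and> Z' \<in> YY \<and>
     ((X' \<notin> {X, Z} \<and> Z' \<notin> {X, Z} \<and> dpi X X' Z' > 2 * xi \<and> dpi Z X' Z' > 2 * xi)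
      \<or> (X' = X \<and> X \<noteq> Z \<and> Z' \<noteq> Z \<and> dpi Z X Z' > 2 * xi)
      \<or> (Z' = Z \<and> X \<noteq> Z \<and> X' \<noteq> X \<and> dpi X X' Z > 2 * xi)
      \<or> (X', Z') = (X, Z))}"

text \<open>d_Y(X,Z): infimum of d^pi_Y(X',Z') over pairs of H(X,Z) on which d^pi_Y is defined
  (i.e. X', Z' different from Y).\<close>
definition dmod :: "'a set \<Rightarrow> ('a \<Rightarrow> 'a \<Rightarrow> 'a \<Rightarrow> real) \<Rightarrow> real \<Rightarrow> 'a \<Rightarrow> 'a \<Rightarrow> 'a \<Rightarrow> real" where
  "dmod YY dpi xi Y X Z =
     Inf ((\<lambda>(X', Z'). dpi Y X' Z') ` {(X', Z') \<in> HH YY dpi xi X Z. X' \<noteq> Y \<and> Z' \<noteq> Y})"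

definition YK :: "'a set \<Rightarrow> ('a \<Rightarrow> 'a \<Rightarrow> 'a \<Rightarrow> real) \<Rightarrow> real \<Rightarrow> real \<Rightarrow> 'a \<Rightarrow> 'a \<Rightarrow> 'a set" where
  "YK YY dpi xi K X Z = {Y \<in> YY - {X, Z}. dmod YY dpi xi Y X Z > K}"

definition PK_edge :: "'a set \<Rightarrow> ('a \<Rightarrow> 'a \<Rightarrow> 'a \<Rightarrow> real) \<Rightarrow> real \<Rightarrow> real \<Rightarrow> 'a \<Rightarrow> 'a \<Rightarrow> bool" where
  "PK_edge YY dpi xi K X Z \<longleftrightarrow> X \<in> YY \<and> Z \<in> YY \<and> X \<noteq> Z \<and> YK YY dpi xi K X Z = {}"

definition walk :: "'b set \<Rightarrow> ('b \<Rightarrow> 'b \<Rightarrow> bool) \<Rightarrow> 'b list \<Rightarrow> bool" where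
  "walk V E xs \<longleftrightarrow> xs \<noteq> [] \<and> set xs \<subseteq> V \<and> (\<forall>i. Suc i < length xs \<longrightarrow> E (xs ! i) (xs ! Suc i))"

definition walk_from_to :: "'b set \<Rightarrow> ('b \<Rightarrow> 'b \<Rightarrow> bool) \<Rightarrow> 'b \<Rightarrow> 'b \<Rightarrow> 'b list \<Rightarrow> bool" where
  "walk_from_to V E x y xs \<longleftrightarrow> walk V E xs \<and> hd xs = x \<and> last xs = y"

definition graph_connected :: "'b set \<Rightarrow> ('b \<Rightarrow> 'b \<Rightarrow> bool) \<Rightarrow> bool" where
  "graph_connected V E \<longleftrightarrow> (\<forall>x\<in>V. \<forall>y\<in>V. \<exists>xs. walk_from_to V E x y xs)"

text \<open>Path metric (every edge has length 1); meaningful for connected graphs.\<close>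
definition gdist :: "'b set \<Rightarrow> ('b \<Rightarrow> 'b \<Rightarrow> bool) \<Rightarrow> 'b \<Rightarrow> 'b \<Rightarrow> real" where
  "gdist V E x y = real (LEAST n. \<exists>xs. walk_from_to V E x y xs \<and> length xs = Suc n)"

definition is_tree :: "'b set \<Rightarrow> ('b \<Rightarrow> 'b \<Rightarrow> bool) \<Rightarrow> bool" where
  "is_tree T F \<longleftrightarrow>
     (\<forall>x y. F x y \<longrightarrow> x \<in> T \<and> y \<in> T \<and> F y x \<and> x \<noteq> y) \<and>
     graph_connected T F \<and>
     (\<forall>x y xs ys. walk_from_to T F x y xs \<and> distinct xs \<and> walk_from_to T F x y ys \<and> distinct ys
        \<longrightarrow> xs = ys)"

definition quasi_isometric :: "'b set \<Rightarrow> ('b \<Rightarrow> 'b \<Rightarrow> real) \<Rightarrow> 'c set \<Rightarrow> ('c \<Rightarrow> 'c \<Rightarrow> real) \<Rightarrow> bool" where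
  "quasi_isometric A dA B dB \<longleftrightarrow>
     (\<exists>f L C. f ` A \<subseteq> B \<and> L \<ge> 1 \<and> C \<ge> 0 \<and>
        (\<forall>x\<in>A. \<forall>y\<in>A. dB (f x) (f y) \<le> L * dA x y + C \<and> dA x y \<le> L * dB (f x) (f y) + C) \<and>
        (\<forall>b\<in>B. \<exists>a\<in>A. dB b (f a) \<le> C))"

text \<open>A graph is a quasi-tree if (with its path metric) it is quasi-isometric to a
  simplicial tree. Tree vertices are taken in the type 'b set, which is large enough.\<close>
definition quasi_tree :: "'b set \<Rightarrow> ('b \<Rightarrow> 'b \<Rightarrow> bool) \<Rightarrow> bool" where
  "quasi_tree V E \<longleftrightarrow> graph_connected V E \<and>
     (\<exists>(T :: 'b set set) F. is_tree T F \<and> quasi_isometric V (gdist V E) T (gdist T F))"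

end

(* With dm the modified distance dmod, monotonicity is exact: if dpi Y X Z is large then
   dm W X Y <= dm W X Z. Hence every X, Z are joined by a path inside {X, Z} and YK X Z. Exact
   monotonicity also makes "dm G E A > c" a transitive relation in G and E, so that no constants
   accumulate along a path far from A: the projections of its end points to A are 4 xi-close.
   Thus every path from X to Z passes within 2 of each Y in YK X Z. Now let x, y have the same
   distance n from a base point p and be joined by a path outside the open n-ball. Applied to this
   path and to the geodesics through p, the barrier property puts each Y in YK x y within 6 of x
   or y, so d x y <= 13. Therefore collapsing each component of the complement of the open n-ball,
   for all n, distorts distances by a bounded amount, and these components form a rooted tree. *)
theory Submission
  imports Defs
begin

section \<open>Rooted trees described by a level function\<close>

lemma walk_iff_successively: "walk V E xs \<longleftrightarrow> xs \<noteq> [] \<and> set xs \<subseteq> V \<and> successively E xs"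
  unfolding walk_def successively_conv_nth by auto

text \<open>Certificate for a rooted tree: \<open>lev\<close> is the depth and the neighbour of
  smaller level is the parent. Acyclicity is not assumed; it follows from the uniqueness of
  parents.\<close>

locale rooted_levels =
  fixes T :: "'b set" and F :: "'b \<Rightarrow> 'b \<Rightarrow> bool" and lev :: "'b \<Rightarrow> nat"
  assumes edge: "F a b \<Longrightarrow> a \<in> T \<and> b \<in> T \<and> F b a \<and> (lev a = Suc (lev b) \<or> lev b = Suc (lev a))"
    and parent_unique: "\<lbrakk>F a b; F a c; lev b < lev a; lev c < lev a\<rbrakk> \<Longrightarrow> b = c"
    and parent_ex: "\<lbrakk>a \<in> T; 0 < lev a\<rbrakk> \<Longrightarrow> \<exists>b. F a b \<and> lev b < lev a"
    and root_unique: "\<lbrakk>a \<in> T; b \<in> T; lev a = 0; lev b = 0\<rbrakk> \<Longrightarrow> a = b"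
begin

text \<open>Once a simple walk has gone up it cannot turn down: at the turning vertex both the
  previous and the next vertex would be its unique parent.\<close>

lemma ascent:
  "\<lbrakk>successively F (x # z # zs); distinct (x # z # zs); lev x < lev z\<rbrakk> \<Longrightarrow> lev x < lev (last (z # zs))"
proof (induction zs arbitrary: x z)
  case (Cons w ws)
  have "F z x" "F z w" "x \<noteq> w" "lev z = Suc (lev w) \<or> lev w = Suc (lev z)" 
    using Cons.prems edge[of x z] edge[of z w] by simp_all
  then have "lev z < lev w" using parent_unique[of z x w] Cons.prems(3) by linarith
  then show ?case using Cons.IH[of z w] Cons.prems by auto
qed simp

text \<open>By \<open>ascent\<close>, a simple walk starting at the end of larger (or equal) level
  must first step to the parent. Two such walks share this step, and the sum of the levels
  drops.\<close>

lemma simple_walk_unique: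
  assumes "walk_from_to T F x y xs" "distinct xs" "walk_from_to T F x y ys" "distinct ys"
  shows "xs = ys"
  using assms
proof (induction "lev x + lev y" arbitrary: x y xs ys rule: less_induct)
  case less
  \<comment> \<open>The induction bound gets its own copy \<open>x0\<close>, \<open>y0\<close>, so
    that the claim also applies to the reversed walks.\<close>
  have descend: "xs = ys" if le: "lev y \<le> lev x" and s: "lev x + lev y = lev x0 + lev y0"
    and xs: "walk_from_to T F x y xs" "distinct xs" and ys: "walk_from_to T F x y ys" "distinct ys"
    and IH: "\<And>x y xs ys. \<lbrakk>lev x + lev y < lev x0 + lev y0; walk_from_to T F x y xs; distinct xs;
      walk_from_to T F x y ys; distinct ys\<rbrakk> \<Longrightarrow> xs = ys"
    for x y xs ys x0 y0
  proof (cases "x = y")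
    case True
    have "zs = [x]" if "walk_from_to T F x y zs" "distinct zs" for zs
    proof (cases zs)
      case (Cons u us)
      have "us = []"
      proof (rule ccontr)
        assume "us \<noteq> []"
        then have "u \<in> set us" 
          using that(1) True Cons last_in_set[of us] by (simp add: walk_from_to_def)
        then show False using that(2) Cons by simp
      qed
      then show ?thesis using that(1) Cons by (simp add: walk_from_to_def)
    qed (use that in \<open>simp add: walk_from_to_def walk_def\<close>)
    then show ?thesis using xs ys by blast
  next
    case False
    have first: "\<exists>z zs'. zs = x # z # zs' \<and> F x z \<and> lev z < lev x \<and> walk_from_to T F z y (z # zs')"
      if zs: "walk_from_to T F x y zs" "distinct zs" for zs
    proof -
      obtain u us where [simp]: "zs = u # us" using zs by (cases zs) (auto simp: walk_from_to_def walk_def)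
      have [simp]: "u = x" using zs by (simp add: walk_from_to_def)
      obtain z zs' where [simp]: "us = z # zs'" 
        using zs False by (cases us) (auto simp: walk_from_to_def)
      have w: "successively F (x # z # zs')" "last (z # zs') = y" 
        using zs by (auto simp: walk_from_to_def walk_iff_successively)
      then have "F x z" "\<not> lev x < lev z" using ascent[OF w(1)] zs(2) w(2) le by auto
      moreover have "walk_from_to T F z y (z # zs')"
        using zs by (auto simp: walk_from_to_def walk_iff_successively)
      ultimately show ?thesis using edge[of x z] by auto
    qed
    obtain z zs where z: "xs = x # z # zs" "F x z" "lev z < lev x" "walk_from_to T F z y (z # zs)"
      using first[OF xs] by blast
    obtain z' zs' where z': "ys = x # z' # zs'" "F x z'" "lev z' < lev x" "walk_from_to T F z' y (z' # zs')"
      using first[OF ys] by blast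
    have "z' = z" using parent_unique z z' by blast
    then show ?thesis using IH[of z y "z # zs" "z' # zs'"] z z' xs ys s by auto
  qed
  have rev: "walk_from_to T F b a (rev zs)" if "walk_from_to T F a b zs" for a b zs
  proof -
    have "successively (\<lambda>x y. F y x) zs"
      using that edge by (auto simp: walk_from_to_def walk_iff_successively intro: successively_mono)
    then show ?thesis using that by (auto simp: walk_from_to_def walk_iff_successively hd_rev last_rev)
  qed
  show ?case
  proof (cases "lev y \<le> lev x")
    case True
    show ?thesis by (rule descend[OF True refl less.prems]) (rule less.hyps)
  next
    case False
    have "rev xs = rev ys"
      by (rule descend[of x y x y "rev xs" "rev ys"]) 
        (use False less.prems rev less.hyps in \<open>simp_all add: add.commute\<close>)
    then show ?thesis by simp
  qed
qed

lemma to_root: "a \<in> T \<Longrightarrow> \<exists>r\<in>T. lev r = 0 \<and> F\<^sup>*\<^sup>* a r"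
proof (induction "lev a" arbitrary: a rule: less_induct)
  case less
  show ?case
  proof (cases "lev a = 0")
    case False
    then obtain b where "F a b" "lev b < lev a" using parent_ex less.prems by blast
    then show ?thesis using less.hyps[of b] edge[of a b] by (meson converse_rtranclp_into_rtranclp)
  qed (use less.prems in auto)
qed

lemma connected: "a \<in> T \<Longrightarrow> b \<in> T \<Longrightarrow> F\<^sup>*\<^sup>* a b"
proof -
  assume "a \<in> T" "b \<in> T"
  then obtain r where "F\<^sup>*\<^sup>* a r" "F\<^sup>*\<^sup>* b r" using to_root root_unique by metis
  moreover have "symp F" using edge by (auto intro: sympI)
  ultimately show ?thesis by (meson rtranclp_trans sympD symp_rtranclp)
qed

end

section \<open>The path metric through powers of the edge relation\<close>

lemma relpowp_imp_walk:
  assumes E: "\<And>a b. E a b \<Longrightarrow> a \<in> V \<and> b \<in> V" and "x \<in> V" "(E ^^ n) x y"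
  shows "\<exists>xs. walk_from_to V E x y xs \<and> length xs = Suc n"
  using assms(2,3)
proof (induction n arbitrary: x)
  case 0
  then show ?case by (intro exI[of _ "[x]"]) (auto simp: walk_from_to_def walk_def)
next
  case (Suc n)
  then obtain z where z: "E x z" "(E ^^ n) z y" by (meson relpowp_Suc_E2)
  then obtain xs where "walk_from_to V E z y xs" "length xs = Suc n" using Suc.IH[of z] E by auto
  then show ?case using z(1) E[of x z]
    by (intro exI[of _ "x # xs"])
      (cases xs; auto simp: walk_from_to_def walk_iff_successively)
qed

lemma walk_imp_relpowp: "walk_from_to V E x y xs \<Longrightarrow> (E ^^ (length xs - 1)) x y"
proof (induction xs arbitrary: x)
  case (Cons a xs)
  show ?case
  proof (cases xs)
    case Nil
    then show ?thesis using Cons.prems by (auto simp: walk_from_to_def)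
  next
    case (Cons b ys)
    then have "E x b" "(E ^^ (length xs - 1)) b y" 
      using Cons.prems Cons.IH[of b] by (auto simp: walk_from_to_def walk_iff_successively)
    then show ?thesis using Cons relpowp_Suc_I2[of E x b] by auto
  qed
qed (auto simp: walk_from_to_def walk_def)

locale connected_graph =
  fixes V :: "'b set" and E :: "'b \<Rightarrow> 'b \<Rightarrow> bool"
  assumes edge_in: "E a b \<Longrightarrow> a \<in> V \<and> b \<in> V"
    and edge_sym: "E a b \<Longrightarrow> E b a"
    and conn: "a \<in> V \<Longrightarrow> b \<in> V \<Longrightarrow> E\<^sup>*\<^sup>* a b"
begin

text \<open>Powers of the edge relation make concatenation and reversal algebraic;
  \<open>gdist_nd\<close> identifies this number with the path metric.\<close>

definition nd :: "'b \<Rightarrow> 'b \<Rightarrow> nat" where "nd x y = (LEAST n. (E ^^ n) x y)"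

lemma gdist_nd:
  assumes "x \<in> V"
  shows "gdist V E x y = real (nd x y)"
proof -
  have "(\<exists>xs. walk_from_to V E x y xs \<and> length xs = Suc n) \<longleftrightarrow> (E ^^ n) x y" for n
    using relpowp_imp_walk[of E V x n y] walk_imp_relpowp[of V E x y] edge_in assms by force
  then show ?thesis unfolding gdist_def nd_def by simp
qed

lemma graph_connected: "graph_connected V E"
  unfolding graph_connected_def 
  using relpowp_imp_walk[of E V] conn edge_in rtranclp_imp_relpowp[of E] by metis

lemma nd_power: "x \<in> V \<Longrightarrow> y \<in> V \<Longrightarrow> (E ^^ nd x y) x y"
  unfolding nd_def using rtranclp_imp_relpowp[OF conn] by (metis LeastI)

lemma nd_le: "(E ^^ n) x y \<Longrightarrow> nd x y \<le> n"
  unfolding nd_def by (rule Least_le)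

lemma nd_self [simp]: "nd x x = 0"
  using nd_le[of 0 x x] by simp

lemma nd_eq_0: "x \<in> V \<Longrightarrow> y \<in> V \<Longrightarrow> nd x y = 0 \<longleftrightarrow> x = y"
  using nd_power[of x y] by auto

lemma power_sym: "(E ^^ n) x y \<Longrightarrow> (E ^^ n) y x"
proof (induction n arbitrary: y)
  case (Suc n)
  then show ?case using relpowp_Suc_I2[of E y] edge_sym by (metis relpowp_Suc_E)
qed simp

lemma nd_sym: "nd x y = nd y x"
  unfolding nd_def using power_sym by metis

lemma nd_triangle: "\<lbrakk>x \<in> V; y \<in> V; z \<in> V\<rbrakk> \<Longrightarrow> nd x z \<le> nd x y + nd y z"
  using nd_le[of "nd x y + nd y z" x z] nd_power[of x y] nd_power[of y z] by (auto simp: relpowp_add)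

lemma nd_edge: "E x y \<Longrightarrow> nd x y \<le> 1"
  by (metis nd_le relpowp_1)

lemma nd_step: "E y z \<Longrightarrow> x \<in> V \<Longrightarrow> nd x z \<le> nd x y + 1"
  using nd_triangle[of x y z] nd_edge[of y z] edge_in[of y z] by auto

lemma nd_descend:
  assumes "x \<in> V" "y \<in> V" "0 < nd x y"
  obtains z where "E y z" "nd x y = Suc (nd x z)"
proof -
  obtain m where m: "nd x y = Suc m" using assms by (cases "nd x y") auto
  then have "(E ^^ Suc m) x y" using nd_power assms by metis
  then obtain z where z: "(E ^^ m) x z" "E z y" by (meson relpowp_Suc_E)
  then have "nd x z \<le> m" using nd_le by simp
  then show ?thesis using that[of z] z edge_sym nd_step[OF z(2) assms(1)] m by auto
qed

abbreviation inside :: "'b set \<Rightarrow> 'b \<Rightarrow> 'b \<Rightarrow> bool" where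
  "inside U a b \<equiv> E a b \<and> a \<in> U \<and> b \<in> U"

lemma inside_sym: "(inside U)\<^sup>*\<^sup>* a b \<Longrightarrow> (inside U)\<^sup>*\<^sup>* b a"
  by (rule sympD[OF symp_rtranclp]) (auto intro: sympI edge_sym)

lemma inside_mono: "(inside U)\<^sup>*\<^sup>* a b \<Longrightarrow> U \<subseteq> U' \<Longrightarrow> (inside U')\<^sup>*\<^sup>* a b"
  by (erule rtranclp_mono[THEN predicate2D, rotated]) auto

lemma inside_in: "(inside U)\<^sup>*\<^sup>* a b \<Longrightarrow> a \<in> U \<Longrightarrow> b \<in> U"
  by (induction rule: rtranclp_induct) auto

text \<open>The set is the metric interval between \<open>x\<close> and \<open>p\<close>. A step
  that decreases the distance to \<open>p\<close> stays in it, by the triangle inequality.\<close>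

lemma geodesic:
  assumes "p \<in> V" "x \<in> V" "z \<in> V" "nd x z + nd p z = nd p x"
  shows "(inside {u. nd x u + nd p u = nd p x})\<^sup>*\<^sup>* z p"
  using assms(3,4)
proof (induction "nd p z" arbitrary: z rule: less_induct)
  case less
  show ?case
  proof (cases "nd p z = 0")
    case True
    then show ?thesis using nd_eq_0 less assms by auto
  next
    case False
    then obtain w where w: "E z w" "nd p z = Suc (nd p w)" using nd_descend assms less by blast
    then have "w \<in> V" using edge_in by auto
    have "nd x w + nd p w = nd p x"
      using nd_step[OF w(1) assms(2)] nd_triangle[of x w p] assms \<open>w \<in> V\<close> w(2) less.prems
      by (auto simp: nd_sym)
    then show ?thesis using less.hyps[of w] w \<open>w \<in> V\<close> less.prems
      by (intro converse_rtranclp_into_rtranclp[of "inside _" z w]) auto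
  qed
qed

section \<open>A bottleneck criterion for quasi-trees\<close>

text \<open>The tree: its vertices are the connected components \<open>f x\<close> of the complements of open balls about \<open>p\<close>
  (here \<open>U n\<close> is the complement of the open \<open>n\<close>-ball), ordered by inclusion. Components of different levels
  differ as sets because the level is the least distance to \<open>p\<close>.\<close>

lemma bottleneck_quasi_tree:
  assumes p: "p \<in> V"
    and bottleneck: "\<And>x y. \<lbrakk>x \<in> V; y \<in> V; nd p x = nd p y; (inside {z \<in> V. nd p x \<le> nd p z})\<^sup>*\<^sup>* x y\<rbrakk> 
      \<Longrightarrow> nd x y \<le> D"
  shows "quasi_tree V E"
proof -
  define l where "l = nd p"
  define U where "U n = {z \<in> V. n \<le> l z}" for n
  define f where "f x = {y. (inside (U (l x)))\<^sup>*\<^sup>* x y}" for x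
  define T where "T = f ` V"
  define lev where "lev C = (LEAST n. \<exists>y\<in>C. l y = n)" for C
  define F where "F a b \<longleftrightarrow> a \<in> T \<and> b \<in> T \<and> (b \<subseteq> a \<and> lev b = Suc (lev a) \<or> a \<subseteq> b \<and> lev a = Suc (lev b))" for a b
  have self: "x \<in> f x" for x by (simp add: f_def)
  have f_in: "y \<in> V \<and> l x \<le> l y" if "x \<in> V" "y \<in> f x" for x y
    using inside_in[of "U (l x)" x y] that by (auto simp: f_def U_def)
  have lev_f: "lev (f x) = l x" if "x \<in> V" for x
    unfolding lev_def by (rule Least_equality) (use self f_in that in auto)
  have U_mono: "U m \<subseteq> U n" if "n \<le> m" for m n using that by (auto simp: U_def)
  \<comment> \<open>Components that share a point are nested: the region of the higher level is
    contained in that of the lower one, so the path from \<open>y\<close> to \<open>z\<close> is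
    also available there.\<close>
  have nested: "f y \<subseteq> f x" if "z \<in> f x" "z \<in> f y" "l x \<le> l y" for x y z
  proof
    fix w assume "w \<in> f y"
    then have "(inside (U (l x)))\<^sup>*\<^sup>* y w" "(inside (U (l x)))\<^sup>*\<^sup>* z y" "(inside (U (l x)))\<^sup>*\<^sup>* x z"
      using that inside_mono[OF _ U_mono[OF that(3)]] inside_sym by (auto simp: f_def)
    then show "w \<in> f x" unfolding f_def by auto
  qed
  have nested_T: "b \<subseteq> a" if abc: "a \<in> T" "b \<in> T" "c \<in> T" "c \<subseteq> a" "c \<subseteq> b" "lev a \<le> lev b" for a b c
  proof -
    obtain x y z where "x \<in> V" "a = f x" "y \<in> V" "b = f y" "c = f z"
      using abc(1-3) by (auto simp: T_def)
    then show ?thesis using nested[of z x y] self[of z] lev_f abc(4-6) by auto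
  qed
  have edge_up: "f y \<subseteq> f x" if "E x y" "l x \<le> l y" for x y
  proof (rule nested[OF _ self that(2)])
    show "y \<in> f x" using that edge_in[of x y] by (auto simp: f_def U_def)
  qed
  \<comment> \<open>Walking towards \<open>p\<close>, each step lowers the level by one and enlarges
    the component.\<close>
  have ancestor: "\<exists>x'\<in>V. l x' = m \<and> f x \<subseteq> f x' \<and> nd x x' \<le> l x - m" if "x \<in> V" "m \<le> l x" for x m
    using that
  proof (induction "l x" arbitrary: x rule: less_induct)
    case less
    show ?case
    proof (cases "l x = m")
      case False
      then obtain z where z: "E x z" "l x = Suc (l z)" 
        using nd_descend[OF p less.prems(1)] less.prems(2) unfolding l_def by auto
      then have zV: "z \<in> V" using edge_in by auto
      then obtain x' where x': "x' \<in> V" "l x' = m" "f z \<subseteq> f x'" "nd z x' \<le> l z - m"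
        using less.hyps[of z] z less.prems False by auto
      have "f x \<subseteq> f z" using edge_up[of z x] z edge_sym by auto
      moreover have "nd x x' \<le> l x - m" 
        using nd_triangle[of x z x'] nd_edge[OF z(1)] x' zV z(2) less.prems False by auto
      ultimately show ?thesis using x' by blast
    qed (use less.prems in auto)
  qed
  interpret rl: rooted_levels T F lev
  proof
    show "a \<in> T \<and> b \<in> T \<and> F b a \<and> (lev a = Suc (lev b) \<or> lev b = Suc (lev a))" if "F a b" for a b
      using that unfolding F_def by auto
    show "b = c" if "F a b" "F a c" "lev b < lev a" "lev c < lev a" for a b c
      using that nested_T[of b c a] nested_T[of c b a] unfolding F_def by auto
    show "\<exists>b. F a b \<and> lev b < lev a" if a: "a \<in> T" "0 < lev a" for a
    proof -
      obtain x where x: "x \<in> V" "a = f x" using a(1) unfolding T_def by auto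
      then obtain z where z: "E x z" "l x = Suc (l z)" 
        using nd_descend[OF p x(1)] a(2) lev_f unfolding l_def by auto
      then have "F (f x) (f z)" using edge_up[of z x] edge_sym edge_in[of x z] lev_f
        unfolding F_def T_def by auto
      then show ?thesis using x z lev_f edge_in[of x z] by auto
    qed
    show "a = b" if "a \<in> T" "b \<in> T" "lev a = 0" "lev b = 0" for a b
      using that lev_f p nd_eq_0[OF p] unfolding T_def l_def by auto
  qed
  interpret t: connected_graph T F
    by unfold_locales (use rl.edge rl.connected in auto)
  have tree: "is_tree T F"
    unfolding is_tree_def
  proof (intro conjI allI impI)
    show "a \<in> T" "b \<in> T" "F b a" "a \<noteq> b" if "F a b" for a b using rl.edge[OF that] by auto
  qed (use t.graph_connected rl.simple_walk_unique in blast)+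
  have upper: "t.nd (f x) (f y) \<le> nd x y" if "x \<in> V" "y \<in> V" for x y
  proof -
    have "(E ^^ n) x y \<Longrightarrow> t.nd (f x) (f y) \<le> n" for n
    proof (induction n arbitrary: y)
      case (Suc n)
      then obtain z where z: "(E ^^ n) x z" "E z y" by (meson relpowp_Suc_E)
      have zy: "z \<in> V" "y \<in> V" using edge_in z by auto
      have "l y \<le> Suc (l z)" "l z \<le> Suc (l y)" 
        using nd_step[OF z(2) p] nd_step[OF edge_sym[OF z(2)] p] by (auto simp: l_def)
      then consider "l y = l z" | "l y = Suc (l z)" | "l z = Suc (l y)" by linarith
      then have "f z = f y \<or> F (f z) (f y)"
        using edge_up[OF z(2)] edge_up[OF edge_sym[OF z(2)]] zy lev_f by cases (auto simp: F_def T_def)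
      then show ?case using t.nd_step[of "f z" "f y" "f x"] Suc.IH[OF z(1)] \<open>x \<in> V\<close> by (auto simp: T_def)
    qed simp
    then show ?thesis using nd_power that by blast
  qed
  have lower: "nd x y \<le> t.nd (f x) (f y) + D" if xy: "x \<in> V" "y \<in> V" for x y
  proof -
    \<comment> \<open>A tree walk of \<open>n\<close> edges has a common ancestor of its ends with
      level at least \<open>(lev b + lev c - n) / 2\<close>. It is kept while the walk moves, and
      replaced by \<open>c\<close> when the walk leaves it through its parent.\<close>
    have common: "\<exists>a\<in>T. b \<subseteq> a \<and> c \<subseteq> a \<and> lev b + lev c \<le> n + 2 * lev a" if "b \<in> T" "(F ^^ n) b c" for n b c
      using that(2)
    proof (induction n arbitrary: c)
      case 0
      then show ?case using \<open>b \<in> T\<close> by auto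
    next
      case (Suc n)
      then obtain d where d: "(F ^^ n) b d" "F d c" by (meson relpowp_Suc_E)
      then obtain a where a: "a \<in> T" "b \<subseteq> a" "d \<subseteq> a" "lev b + lev d \<le> n + 2 * lev a" using Suc.IH by blast
      have dc: "d \<in> T" "c \<in> T" using d(2) by (auto simp: F_def)
      consider (down) "c \<subseteq> d" "lev c = Suc (lev d)" | (up) "d \<subseteq> c" "lev d = Suc (lev c)"
        using d(2) by (auto simp: F_def)
      then show ?case
      proof cases
        case down
        then show ?thesis using a by (intro bexI[of _ a]) auto
      next
        case up
        show ?thesis
        proof (cases "lev a \<le> lev c")
          case True
          then show ?thesis using a nested_T[OF a(1) dc(2,1) a(3) up(1)] up by (intro bexI[of _ a]) auto
        next
          case False
          then have "a \<subseteq> c" using nested_T[OF dc(2) a(1) dc(1) up(1) a(3)] by auto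
          \<comment> \<open>\<open>d\<close> lies inside \<open>a\<close>, so
            \<open>lev a = lev c + 1\<close>. Passing from \<open>a\<close> to \<open>c\<close>
            costs 2, paid for by the new edge and by the drop from \<open>lev d\<close> to
            \<open>lev c\<close>.\<close>
          moreover have "lev a \<le> lev d"
          proof -
            obtain u v where uv: "u \<in> V" "a = f u" "v \<in> V" "d = f v" using a(1) dc(1) by (auto simp: T_def)
            then have "v \<in> f u" using a(3) self[of v] by auto
            then show ?thesis using f_in[OF uv(1)] lev_f uv by auto
          qed
          ultimately show ?thesis using a up dc False by (intro bexI[of _ c]) auto
        qed
      qed
    qed
    have fT: "f x \<in> T" "f y \<in> T" using xy by (auto simp: T_def)
    then obtain a where a: "a \<in> T" "f x \<subseteq> a" "f y \<subseteq> a" "lev (f x) + lev (f y) \<le> t.nd (f x) (f y) + 2 * lev a"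
      using common[OF fT(1) t.nd_power[OF fT]] by blast
    obtain w where w: "w \<in> V" "a = f w" using a(1) by (auto simp: T_def)
    have xyw: "x \<in> f w" "y \<in> f w" using a(2,3) w(2) self by auto
    then have lw: "l w \<le> l x" "l w \<le> l y" using f_in[OF w(1)] by auto
    \<comment> \<open>Both points are pushed down to the level of the common ancestor. Their images
      lie in one component at one level, where the bottleneck hypothesis applies; the two descents
      together cost at most the tree distance.\<close>
    obtain x' where x': "x' \<in> V" "l x' = l w" "f x \<subseteq> f x'" "nd x x' \<le> l x - l w"
      using ancestor[OF xy(1) lw(1)] by blast
    obtain y' where y': "y' \<in> V" "l y' = l w" "f y \<subseteq> f y'" "nd y y' \<le> l y - l w"
      using ancestor[OF xy(2) lw(2)] by blast
    have "x \<in> f x'" "y \<in> f y'" using x'(3) y'(3) self by auto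
    then have "f x' = f w" "f y' = f w"
      using nested[of x w x'] nested[of x x' w] nested[of y w y'] nested[of y y' w] x'(2) y'(2) xyw by auto
    then have "(inside (U (l x')))\<^sup>*\<^sup>* x' y'" using self[of y'] by (auto simp: f_def)
    then have "nd x' y' \<le> D" using bottleneck[of x' y'] x' y' by (simp add: l_def U_def)
    then have "nd x y \<le> (l x - l w) + D + (l y - l w)"
      using nd_triangle[of x x' y] nd_triangle[of x' y' y] x' y' xy nd_sym[of y y'] by linarith
    then show ?thesis using a(4) lw w(2) lev_f[OF xy(1)] lev_f[OF xy(2)] lev_f[OF w(1)] by simp
  qed
  \<comment> \<open>The map \<open>f\<close> is onto \<open>T\<close>, and only the additive error
    \<open>D\<close> occurs, so the multiplicative constant is 1.\<close>
  have "is_tree T F \<and> quasi_isometric V (gdist V E) T (gdist T F)"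
    unfolding quasi_isometric_def 
  proof (rule conjI[OF tree], rule exI[of _ f], rule exI[of _ 1], rule exI[of _ "real D"], intro conjI ballI)
    show "gdist T F (f x) (f y) \<le> 1 * gdist V E x y + real D"
      "gdist V E x y \<le> 1 * gdist T F (f x) (f y) + real D" if "x \<in> V" "y \<in> V" for x y
      using upper[OF that] lower[OF that] gdist_nd[OF that(1), of y] t.gdist_nd[of "f x" "f y"] that(1)
      by (auto simp: T_def)
    show "\<exists>x\<in>V. gdist T F a (f x) \<le> real D" if a: "a \<in> T" for a
    proof -
      obtain x where "x \<in> V" "a = f x" using a by (auto simp: T_def)
      then show ?thesis using t.gdist_nd[OF a, of a] by (intro bexI[of _ x]) simp_all
    qed
  qed (auto simp: T_def)
  then show ?thesis unfolding quasi_tree_def using graph_connected by blast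
qed

end

section \<open>The projection axioms and the modified distance\<close>

locale projection_system =
  fixes YY :: "'a set" and dpi :: "'a \<Rightarrow> 'a \<Rightarrow> 'a \<Rightarrow> real" and xi :: real
  assumes axioms: "proj_axioms YY dpi xi"
begin

abbreviation dm :: "'a \<Rightarrow> 'a \<Rightarrow> 'a \<Rightarrow> real" where "dm \<equiv> dmod YY dpi xi"

lemma xi_pos: "xi > 0"
  using axioms by (simp add: proj_axioms_def)

lemma dpi_nonneg: "\<lbrakk>Y \<in> YY; X \<in> YY; Z \<in> YY; X \<noteq> Y; Z \<noteq> Y\<rbrakk> \<Longrightarrow> 0 \<le> dpi Y X Z"
  using axioms by (simp add: proj_axioms_def)

lemma dpi_sym: "\<lbrakk>Y \<in> YY; X \<in> YY; Z \<in> YY; X \<noteq> Y; Z \<noteq> Y\<rbrakk> \<Longrightarrow> dpi Y X Z = dpi Y Z X"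
  using axioms by (simp add: proj_axioms_def)

lemma dpi_triangle:
  "\<lbrakk>Y \<in> YY; X \<in> YY; Z \<in> YY; W \<in> YY; X \<noteq> Y; Z \<noteq> Y; W \<noteq> Y\<rbrakk> \<Longrightarrow> dpi Y X W \<le> dpi Y X Z + dpi Y Z W"
  using axioms unfolding proj_axioms_def by blast

lemma dpi_small:
  assumes "X \<in> YY" "Y \<in> YY" "Z \<in> YY" "X \<noteq> Y" "Y \<noteq> Z" "X \<noteq> Z" "xi \<le> dpi Y X Z"
  shows "dpi Z X Y < xi" "dpi Z Y X < xi" "dpi X Y Z < xi" "dpi X Z Y < xi"
proof -
  have *: "min (dpi Y X Z) (dpi Z X Y) < xi" "min (dpi Y Z X) (dpi X Z Y) < xi"
    using axioms assms unfolding proj_axioms_def by metis+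
  show "dpi Z X Y < xi" "dpi X Z Y < xi" 
    using * assms dpi_sym[of Y X Z] by auto
  then show "dpi Z Y X < xi" "dpi X Y Z < xi" 
    using assms dpi_sym by metis+
qed

lemma finite_large: "\<lbrakk>X \<in> YY; Z \<in> YY\<rbrakk> \<Longrightarrow> finite {Y \<in> YY - {X, Z}. xi \<le> dpi Y X Z}"
  using axioms by (simp add: proj_axioms_def)

lemma HH_sym: "(X', Z') \<in> HH YY dpi xi X Z \<Longrightarrow> X \<in> YY \<Longrightarrow> Z \<in> YY \<Longrightarrow> (Z', X') \<in> HH YY dpi xi Z X"
  unfolding HH_def using dpi_sym by (auto; metis)

lemma HH_in: "(X', Z') \<in> HH YY dpi xi X Z \<Longrightarrow> X' \<in> YY \<and> Z' \<in> YY"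
  unfolding HH_def by auto

lemma dm_sym:
  assumes "X \<in> YY" "Z \<in> YY" "Y \<in> YY"
  shows "dm Y X Z = dm Y Z X"
proof -
  have "(\<lambda>(X', Z'). dpi Y X' Z') ` {(X', Z') \<in> HH YY dpi xi X Z. X' \<noteq> Y \<and> Z' \<noteq> Y}
      \<subseteq> (\<lambda>(X', Z'). dpi Y X' Z') ` {(X', Z') \<in> HH YY dpi xi Z X. X' \<noteq> Y \<and> Z' \<noteq> Y}"
    if "X \<in> YY" "Z \<in> YY" for X Z
  proof clarify
    fix X' Z' assume *: "(X', Z') \<in> HH YY dpi xi X Z" "X' \<noteq> Y" "Z' \<noteq> Y"
    show "dpi Y X' Z' \<in> (\<lambda>(X', Z'). dpi Y X' Z') ` {(X', Z') \<in> HH YY dpi xi Z X. X' \<noteq> Y \<and> Z' \<noteq> Y}"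
      using * HH_sym[OF *(1) that] HH_in[OF *(1)] dpi_sym[of Y X' Z'] assms(3)
      by (intro image_eqI[of _ _ "(Z', X')"]) auto
  qed
  from this[of X Z] this[of Z X] assms show ?thesis
    unfolding dmod_def by (metis (no_types, lifting) subset_antisym)
qed

lemma bdd_below_HH:
  assumes "Y \<in> YY"
  shows "bdd_below ((\<lambda>(X', Z'). dpi Y X' Z') ` {(X', Z') \<in> HH YY dpi xi X Z. X' \<noteq> Y \<and> Z' \<noteq> Y})"
  using HH_in dpi_nonneg[OF assms] by (intro bdd_belowI[of _ 0]) auto

lemma self_in_HH: "X \<in> YY \<Longrightarrow> Z \<in> YY \<Longrightarrow> (X, Z) \<in> HH YY dpi xi X Z"
  unfolding HH_def by auto

lemma dm_le_dpi:
  assumes "X \<in> YY" "Y \<in> YY" "Z \<in> YY" "X \<noteq> Y" "Z \<noteq> Y"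
  shows "dm Y X Z \<le> dpi Y X Z"
  unfolding dmod_def using self_in_HH[of X Z] assms 
  by (intro cInf_lower bdd_below_HH) (auto intro!: image_eqI[of _ _ "(X, Z)"])

text \<open>On \<open>X\<close>, the vertex \<open>Y\<close> is \<open>xi\<close>-far from
  \<open>A\<close> or from \<open>B\<close>; axiom (3) then makes that vertex close to
  \<open>X\<close> on \<open>Y\<close>.\<close>

lemma close_to_one:
  assumes "X \<in> YY" "Y \<in> YY" "A \<in> YY" "B \<in> YY" "X \<noteq> Y" "A \<noteq> X" "A \<noteq> Y" "B \<noteq> X" "B \<noteq> Y"
    and "2 * xi < dpi X A B"
  shows "dpi Y X A < xi \<or> dpi Y X B < xi"
proof -
  have "xi \<le> dpi X A Y \<or> xi \<le> dpi X B Y"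
    using dpi_triangle[of X A Y B] dpi_sym[of X Y B] assms by auto
  then show ?thesis using dpi_small[of A X Y] dpi_small[of B X Y] assms by auto
qed

text \<open>By \<open>close_to_one\<close>, an end that is moved is \<open>xi\<close>-close on
  \<open>Y\<close> to \<open>X'\<close> or \<open>Z'\<close>. If both ends choose the same one,
  \<open>dpi Y X Z\<close> is below \<open>2 * xi\<close> outright.\<close>

lemma HH_close:
  assumes "X \<in> YY" "Y \<in> YY" "Z \<in> YY" "X \<noteq> Y" "Z \<noteq> Y" "X \<noteq> Z"
    and H: "(X', Z') \<in> HH YY dpi xi X Z" and ne: "X' \<noteq> Y" "Z' \<noteq> Y"
  shows "dpi Y X Z < dpi Y X' Z' + 2 * xi"
proof -
  have YY': "X' \<in> YY" "Z' \<in> YY" using HH_in[OF H] by auto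
  note sym = dpi_sym[OF assms(2)]
  note tri = dpi_triangle[OF assms(2)]
  have nn: "0 \<le> dpi Y X' Z'" using dpi_nonneg YY' assms by auto
  consider (gen) "X' \<notin> {X, Z}" "Z' \<notin> {X, Z}" "dpi X X' Z' > 2 * xi" "dpi Z X' Z' > 2 * xi"
    | (l) "X' = X" "Z' \<noteq> Z" "dpi Z X Z' > 2 * xi" | (r) "Z' = Z" "X' \<noteq> X" "dpi X X' Z > 2 * xi"
    | (eq) "X' = X" "Z' = Z"
    using H unfolding HH_def by auto
  then show ?thesis
  proof cases
    case gen
    then have "dpi Y X X' < xi \<or> dpi Y X Z' < xi" "dpi Y Z X' < xi \<or> dpi Y Z Z' < xi"
      using close_to_one assms YY' by auto
    then show ?thesis
      using tri[of X X' Z] tri[of X Z' Z] tri[of X' Z' Z] tri[of Z' X' Z] 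
        sym[of Z Z'] sym[of Z X'] sym[of Z' X'] nn assms YY' by auto
  next
    case l
    then have "dpi Y Z X < xi \<or> dpi Y Z Z' < xi"
      using close_to_one[of Z Y X Z'] assms YY' by auto
    then show ?thesis using tri[of X Z' Z] sym[of Z X] sym[of Z' Z] nn l assms YY' xi_pos by auto
  next
    case r
    then have "dpi Y X X' < xi \<or> dpi Y X Z < xi"
      using close_to_one[of X Y X' Z] assms YY' by auto
    then show ?thesis using tri[of X X' Z] nn r assms YY' xi_pos by auto
  qed (use xi_pos in auto)
qed

lemma dpi_le_dm:
  assumes "X \<in> YY" "Y \<in> YY" "Z \<in> YY" "X \<noteq> Y" "Z \<noteq> Y" "X \<noteq> Z"
  shows "dpi Y X Z \<le> dm Y X Z + 2 * xi"
proof -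
  have "dpi Y X Z - 2 * xi \<le> dm Y X Z"
    unfolding dmod_def using self_in_HH[of X Z] assms HH_close[OF assms]
    by (intro cInf_greatest) (fastforce dest: less_imp_le)+
  then show ?thesis by simp
qed

text \<open>Guarantees that \<open>dpi Y\<close> is meaningful on every pair of \<open>HH\<close>.
  If \<open>X'\<close> were \<open>Y\<close>, then in the generic case \<open>Z'\<close> would be
  \<open>xi\<close>-close on \<open>Y\<close> to both \<open>X\<close> and \<open>Z\<close>.\<close>

lemma HH_avoids:
  assumes "X \<in> YY" "Y \<in> YY" "Z \<in> YY" "X \<noteq> Y" "Z \<noteq> Y" "X \<noteq> Z"
    and large: "2 * xi \<le> dpi Y X Z" and H: "(X', Z') \<in> HH YY dpi xi X Z"
  shows "X' \<noteq> Y" "Z' \<noteq> Y"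
proof -
  have one_sided: "X' \<noteq> Y" if *: "X \<in> YY" "Z \<in> YY" "X \<noteq> Y" "Z \<noteq> Y" "X \<noteq> Z" 
    "2 * xi \<le> dpi Y X Z" "(X', Z') \<in> HH YY dpi xi X Z" for X Z X' Z'
  proof
    assume [simp]: "X' = Y"
    have Z': "Z' \<in> YY" using HH_in *(7) by auto
    have s: "dpi X Y Z < xi" "dpi X Z Y < xi" "dpi Z Y X < xi"
      using dpi_small[of X Y Z] * assms(2) xi_pos by auto
    consider (gen) "Z' \<notin> {X, Z}" "dpi X Y Z' > 2 * xi" "dpi Z Y Z' > 2 * xi"
      | "dpi X Y Z > 2 * xi"
      using *(3,4,7) unfolding HH_def by auto
    then show False
    proof cases
      case gen
      show False
      proof (cases "Z' = Y")
        \<comment> \<open>The axioms do not make \<open>dpi X Y Y\<close> zero; it is bounded by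
          passing through \<open>Z\<close> and back.\<close>
        case True
        then show False using gen s dpi_triangle[of X Y Z Y] assms * by auto
      next
        case False
        then have "dpi Y X Z' < xi" "dpi Y Z' Z < xi"
          using dpi_small[of Y X Z'] dpi_small[of Y Z Z'] gen * Z' assms(2) xi_pos by auto
        then show False using dpi_triangle[of Y X Z' Z] * Z' False assms(2) by auto
      qed
    qed (use s xi_pos in auto)
  qed
  show "X' \<noteq> Y" using one_sided[OF assms(1,3-8)] .
  show "Z' \<noteq> Y" using one_sided[of Z X Z' X'] HH_sym[OF H assms(1,3)] assms dpi_sym[of Y X Z] by auto
qed

text \<open>Monotonicity without any additive error; this is what the passage from \<open>dpi\<close> to
  \<open>dm\<close> buys, and it is what keeps constants from accumulating along paths.\<close>

lemma dm_mono:
  assumes "X \<in> YY" "Y \<in> YY" "Z \<in> YY" "X \<noteq> Y" "Z \<noteq> Y" "X \<noteq> Z"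
    and large: "4 * xi \<le> dpi Y X Z" and W: "W \<in> YY" "W \<noteq> X" "W \<noteq> Y" "W \<noteq> Z"
  shows "dm W X Y \<le> dm W X Z"
proof -
  \<comment> \<open>A larger set of pairs has a smaller infimum. The condition at \<open>Z\<close>
    is replaced by one at \<open>Y\<close>: of the \<open>4 * xi\<close>, \<open>HH_close\<close>
    uses up \<open>2 * xi\<close> and leaves the threshold in \<open>HH\<close>.\<close>
  have "HH YY dpi xi X Z \<subseteq> HH YY dpi xi X Y"
  proof clarify
    fix X' Z' assume H: "(X', Z') \<in> HH YY dpi xi X Z"
    have ne: "X' \<noteq> Y" "Z' \<noteq> Y" using HH_avoids[OF assms(1-6) _ H] large xi_pos by auto
    have "2 * xi < dpi Y X' Z'" using HH_close[OF assms(1-6) H ne] large by simp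
    then show "(X', Z') \<in> HH YY dpi xi X Y" using H ne assms(4-6) unfolding HH_def by auto
  qed
  then show ?thesis
    unfolding dmod_def using self_in_HH[of X Z] assms
    by (intro cInf_superset_mono bdd_below_HH image_mono) auto
qed

lemma dm_mono':
  assumes "X \<in> YY" "Y \<in> YY" "Z \<in> YY" "X \<noteq> Y" "Z \<noteq> Y" "X \<noteq> Z"
    and "4 * xi \<le> dpi Y X Z" and "W \<in> YY" "W \<noteq> X" "W \<noteq> Y" "W \<noteq> Z"
  shows "dm W Y Z \<le> dm W X Z"
  using dm_mono[of Z Y X W] dm_sym dpi_sym[of Y X Z] assms by auto

section \<open>The order of shielding seen from a fixed vertex\<close>

text \<open>Seen from \<open>A\<close>, the vertex \<open>E\<close> lies behind \<open>G\<close>. For fixed \<open>A\<close> and \<open>c \<ge> 4 * xi\<close> this is a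
  strict partial order in \<open>G\<close> and \<open>E\<close>.\<close>

definition shields :: "'a \<Rightarrow> real \<Rightarrow> 'a \<Rightarrow> 'a \<Rightarrow> bool" where
  "shields A c G E \<longleftrightarrow> A \<in> YY \<and> G \<in> YY \<and> E \<in> YY \<and> G \<noteq> A \<and> E \<noteq> A \<and> G \<noteq> E \<and> c < dm G E A"

lemma shields_weaken: "shields A c G E \<Longrightarrow> c' \<le> c \<Longrightarrow> shields A c' G E"
  unfolding shields_def by auto

lemma shields_dpi: "shields A c G E \<Longrightarrow> c < dpi G E A"
  unfolding shields_def using dm_le_dpi[of E G A] by auto

lemma shieldsI: 
  "\<lbrakk>A \<in> YY; G \<in> YY; E \<in> YY; G \<noteq> A; E \<noteq> A; G \<noteq> E; c + 2 * xi < dpi G E A\<rbrakk> \<Longrightarrow> shields A c G E"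
  unfolding shields_def using dpi_le_dm[of E G A] by auto

lemma shields_asym:
  assumes "shields A c G E" "xi \<le> c"
  shows "\<not> shields A c E G"
proof
  assume "shields A c E G"
  then show False
    using shields_dpi[OF assms(1)] shields_dpi[of A c E G] dpi_small[of E G A] assms 
    unfolding shields_def by auto
qed

text \<open>Exact monotonicity at \<open>G\<close> gives \<open>dm F G A \<le> dm F E A\<close>, so
  the bound \<open>c\<close> survives unchanged.\<close>

lemma shields_trans:
  assumes "shields A c F G" "shields A d G E" "xi \<le> c" "4 * xi \<le> d"
  shows "shields A c F E"
proof -
  have "F \<noteq> E" 
    using shields_dpi[OF assms(1)] shields_dpi[OF assms(2)] dpi_small[of G F A] assms xi_pos
    unfolding shields_def by auto
  moreover have "dm F G A \<le> dm F E A" 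
    using dm_mono'[of E G A F] shields_dpi[OF assms(2)] assms \<open>F \<noteq> E\<close> unfolding shields_def by auto
  ultimately show ?thesis using assms unfolding shields_def by auto
qed

text \<open>If \<open>E\<close> and \<open>H\<close> are far apart on \<open>G\<close>, then
  \<open>E\<close> and \<open>G\<close> are close on \<open>H\<close>, so \<open>H\<close> shields
  \<open>G\<close>; otherwise \<open>G\<close> shields \<open>H\<close>. The loss is
  \<open>xi\<close> for the triangle inequality and \<open>2 * xi\<close> for the passage to
  \<open>dm\<close>.\<close>

lemma shields_compare:
  assumes "A \<in> YY" "G \<in> YY" "H \<in> YY" "E \<in> YY" "A \<notin> {G, H, E}" "G \<noteq> E" "H \<noteq> E" "G \<noteq> H"
    and "c < dpi G E A" "d < dpi H E A"
  shows "shields A (c - 3 * xi) G H \<or> shields A (d - 3 * xi) H G"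
proof (cases "xi \<le> dpi G E H")
  case True
  then have "dpi H E G < xi" using dpi_small[of E G H] assms by auto
  then have "d - xi < dpi H G A" using dpi_triangle[of H E G A] assms by auto
  then show ?thesis using shieldsI[of A H G "d - 3 * xi"] assms by auto
next
  case False
  then have "c - xi < dpi G H A" using dpi_triangle[of G E H A] assms by auto
  then show ?thesis using shieldsI[of A G H "c - 3 * xi"] assms by auto
qed

end

section \<open>Dominating elements of chains\<close>

text \<open>Comparability of two elements above a third one loses a constant: in one direction it
  yields only \<open>W\<close>. The loss does not accumulate along the chain because \<open>S\<close> is transitive.\<close>

lemma chain_dominated:
  fixes D :: "nat \<Rightarrow> 'b" and R S W :: "'b \<Rightarrow> 'b \<Rightarrow> bool"
  assumes RS: "\<And>x y. R x y \<Longrightarrow> S x y" and SW: "\<And>x y. S x y \<Longrightarrow> W x y"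
    and trans: "\<And>x y z. S x y \<Longrightarrow> S y z \<Longrightarrow> S x z"
    and asym: "\<And>x y. W x y \<Longrightarrow> \<not> W y x"
    and compare: "\<And>g h e. R g e \<Longrightarrow> S h e \<Longrightarrow> g = h \<or> S g h \<or> W h g"
    and chain: "\<And>i. i < n \<Longrightarrow> D i = D (Suc i) \<or> R (D i) (D (Suc i)) \<or> R (D (Suc i)) (D i)"
    and "i \<le> j" "j \<le> n"
  shows "\<exists>g\<in>{i..j}. \<forall>k\<in>{i..j}. S\<^sup>=\<^sup>= (D g) (D k)"
  using \<open>i \<le> j\<close> \<open>j \<le> n\<close>
proof (induction "j - i" arbitrary: i j rule: less_induct)
  case less
  have tr: "S\<^sup>=\<^sup>= x z" if "S\<^sup>=\<^sup>= x y" "S\<^sup>=\<^sup>= y z" for x y z using that trans by blast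
  define dom where "dom x a b \<longleftrightarrow> (\<forall>k\<in>{a..b}. S\<^sup>=\<^sup>= x (D k))" for x a b
  have dom_trans: "dom x a b" if "S\<^sup>=\<^sup>= x y" "dom y a b" for x y a b
    using that tr unfolding dom_def by metis
  have "\<exists>g\<in>{i..j}. dom (D g) i j"
  proof (cases "i = j")
    case True
    then show ?thesis by (auto simp: dom_def)
  next
    case False
    with less.prems have ij: "Suc i \<le> j" by simp
    obtain g where g: "g \<in> {Suc i..j}" "dom (D g) (Suc i) j"
      using less.hyps[of j "Suc i"] ij less.prems unfolding dom_def by fastforce
    have join: "dom x i j" if "dom x i m" "dom x (Suc i) j" "i \<le> m" for x m
      unfolding dom_def
    proof
      fix k assume "k \<in> {i..j}"
      then consider "k = i" | "k \<in> {Suc i..j}" by force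
      then show "S\<^sup>=\<^sup>= x (D k)" using that unfolding dom_def by cases auto
    qed
    have g_done: ?thesis if "S\<^sup>=\<^sup>= (D g) (D i)"
      using g join[of "D g" i] that by (intro bexI[of _ g]) (auto simp: dom_def)
    have i_done: ?thesis if "S\<^sup>=\<^sup>= (D i) (D g)"
      using join[of "D i" i] dom_trans[OF that g(2)] ij 
      by (intro bexI[of _ i]) (auto simp: dom_def)
    have g_first: "S\<^sup>=\<^sup>= (D g) (D (Suc i))" using g ij unfolding dom_def by auto
    consider "D i = D (Suc i) \<or> R (D (Suc i)) (D i)" | (down) "R (D i) (D (Suc i))"
      using chain[of i] ij less.prems by auto
    then show ?thesis
    proof cases
      case 1
      then show ?thesis using g_done tr[OF g_first] RS by auto
    next
      case down
      show ?thesis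
      proof (cases "D g = D (Suc i)")
        case True
        then show ?thesis using i_done RS down by auto
      next
        case False
        then have "S (D g) (D (Suc i))" using g_first by auto
        then consider "S\<^sup>=\<^sup>= (D i) (D g)" | (W) "W (D g) (D i)" using compare[OF down] by auto
        then show ?thesis
        proof cases
          \<comment> \<open>The comparison of \<open>D i\<close> with \<open>D g\<close> gave only
            \<open>W\<close>. The neighbour \<open>l\<close> before \<open>g\<close> decides: either
            a dominator of \<open>{i..l}\<close> other than \<open>i\<close> lies below
            \<open>D g\<close>, or comparing \<open>D g\<close> with \<open>D i\<close> above
            \<open>D l\<close> yields \<open>S\<close>, as asymmetry of \<open>W\<close> excludes
            the other direction.\<close>
          case W
          have "g \<noteq> Suc i" using False by auto
          then obtain l where l: "g = Suc l" "Suc i \<le> l" "l < j" using g(1) by (cases g) auto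
          obtain h where h: "h \<in> {i..l}" "dom (D h) i l"
            using less.hyps[of l i] l less.prems unfolding dom_def by fastforce
          show ?thesis
          proof (cases "h = i")
            case hi: False
            then have "S\<^sup>=\<^sup>= (D g) (D h)" using g(2) h(1) l unfolding dom_def by auto
            then have "dom (D g) i l" using dom_trans h(2) by blast
            then show ?thesis using g_done l unfolding dom_def by auto
          next
            case True
            then have il: "S\<^sup>=\<^sup>= (D i) (D l)" using h(2) l unfolding dom_def by auto
            consider "S\<^sup>=\<^sup>= (D l) (D g)" | (R) "R (D g) (D l)" using chain[of l] l less.prems RS by auto
            then show ?thesis
            proof cases
              case 1
              then show ?thesis using i_done tr[OF il] by blast
            next
              case R
              show ?thesis
              proof (cases "D i = D l")
                case True
                then show ?thesis using g_done R RS by auto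
              next
                case False
                then show ?thesis using compare[OF R, of "D i"] il g_done asym[OF W] by auto
              qed
            qed
          qed
        qed (use i_done in blast)
      qed
    qed
  qed
  then show ?case unfolding dom_def .
qed

section \<open>Standard paths and barriers in the projection complex\<close>

locale projection_complex = projection_system YY dpi xi
  for YY :: "'a set" and dpi xi +
  fixes K :: real
  assumes K_large: "20 * xi \<le> K"
begin

abbreviation adj :: "'a \<Rightarrow> 'a \<Rightarrow> bool" where "adj \<equiv> PK_edge YY dpi xi K"
abbreviation between :: "'a \<Rightarrow> 'a \<Rightarrow> 'a set" where "between \<equiv> YK YY dpi xi K"

lemma between_sym: "X \<in> YY \<Longrightarrow> Z \<in> YY \<Longrightarrow> between X Z = between Z X"
  unfolding YK_def using dm_sym by auto

lemma adj_sym: "adj X Z \<Longrightarrow> adj Z X"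
  unfolding PK_edge_def using between_sym by auto

lemma betweenD:
  assumes "X \<in> YY" "Z \<in> YY" "Y \<in> between X Z"
  shows "Y \<in> YY" "Y \<noteq> X" "Y \<noteq> Z" "K < dm Y X Z" "K < dpi Y X Z" "4 * xi \<le> dpi Y X Z"
  using assms dm_le_dpi[of X Y Z] K_large xi_pos unfolding YK_def by auto

lemma finite_between: "X \<in> YY \<Longrightarrow> Z \<in> YY \<Longrightarrow> finite (between X Z)"
  using betweenD[of X Z] xi_pos by (intro finite_subset[OF _ finite_large[of X Z]]) force+

lemma between_subset:
  assumes "X \<in> YY" "Y \<in> YY" "Z \<in> YY" "X \<noteq> Y" "Z \<noteq> Y" "X \<noteq> Z" "4 * xi \<le> dpi Y X Z"
  shows "between X Y \<subseteq> between X Z"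
proof
  fix W assume "W \<in> between X Y"
  note W = betweenD[OF assms(1,2) this]
  have "W \<noteq> Z" using W dpi_small[of X Y Z] assms K_large xi_pos by auto
  then show "W \<in> between X Z" using W dm_mono[OF assms, of W] unfolding YK_def by auto
qed

lemma between_subset':
  assumes "X \<in> YY" "Z \<in> YY" "X \<noteq> Z" "Y \<in> between X Z"
  shows "between X Y \<subset> between X Z" "between Y Z \<subset> between X Z"
proof -
  note Y = betweenD[OF assms(1,2,4)]
  have "Y \<notin> between X Y" "Y \<notin> between Z Y" by (auto simp: YK_def)
  moreover have "between X Y \<subseteq> between X Z" "between Z Y \<subseteq> between Z X"
    using between_subset[of X Y Z] between_subset[of Z Y X] Y assms dpi_sym[of Y X Z] by auto
  ultimately show "between X Y \<subset> between X Z" "between Y Z \<subset> between X Z"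
    using between_sym assms Y by blast+
qed

text \<open>Cutting at any \<open>Y\<close> between \<open>X\<close> and \<open>Z\<close> leaves two
  problems whose \<open>between\<close> sets are strictly smaller and contained in the old one;
  these sets are finite by axiom (4).\<close>

lemma standard_path:
  assumes "X \<in> YY" "Z \<in> YY" "X \<noteq> Z"
  shows "(\<lambda>a b. adj a b \<and> a \<in> {X, Z} \<union> between X Z \<and> b \<in> {X, Z} \<union> between X Z)\<^sup>*\<^sup>* X Z"
  using assms
proof (induction "card (between X Z)" arbitrary: X Z rule: less_induct)
  case less
  let ?R = "\<lambda>X Z a b. adj a b \<and> a \<in> {X, Z} \<union> between X Z \<and> b \<in> {X, Z} \<union> between X Z"
  show ?case
  proof (cases "between X Z = {}")
    case True
    then have "?R X Z X Z" using less.prems by (simp add: PK_edge_def)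
    then show ?thesis by (rule r_into_rtranclp)
  next
    case False
    then obtain Y where Y: "Y \<in> between X Z" by blast
    note Y' = betweenD[OF less.prems(1,2) Y]
    note sub = between_subset'[OF less.prems Y]
    note smaller = sub[THEN psubset_card_mono[OF finite_between[OF less.prems(1,2)]]]
    have "(?R X Y)\<^sup>*\<^sup>* X Y" "(?R Y Z)\<^sup>*\<^sup>* Y Z"
      using less.hyps[OF smaller(1)] less.hyps[OF smaller(2)] less.prems Y' by auto
    moreover have "?R X Y \<le> ?R X Z" "?R Y Z \<le> ?R X Z" using sub Y by auto
    ultimately have "(?R X Z)\<^sup>*\<^sup>* X Y" "(?R X Z)\<^sup>*\<^sup>* Y Z" using rtranclp_mono by blast+
    then show ?thesis by (rule rtranclp_trans)
  qed
qed

sublocale connected_graph YY adj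
proof
  show "adj a b \<Longrightarrow> a \<in> YY \<and> b \<in> YY" for a b by (simp add: PK_edge_def)
  show "adj\<^sup>*\<^sup>* a b" if "a \<in> YY" "b \<in> YY" for a b
    using standard_path[OF that] by (cases "a = b") (auto elim: rtranclp_mono[THEN predicate2D, rotated])
qed (rule adj_sym)

text \<open>A large projection of the edge to \<open>Y\<close> would put \<open>between X Y\<close>
  inside the empty set \<open>between X X'\<close>, making \<open>Y\<close> a neighbour of
  \<open>X\<close>.\<close>

lemma step_small:
  assumes "adj X X'" "Y \<in> YY" "Y \<noteq> X" "\<not> adj X Y"
  shows "X' \<noteq> Y" "dpi Y X X' < 4 * xi"
proof -
  show ne: "X' \<noteq> Y" using assms by auto
  have X: "X \<in> YY" "X' \<in> YY" "X \<noteq> X'" "between X X' = {}" using assms by (auto simp: PK_edge_def)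
  show "dpi Y X X' < 4 * xi"
  proof (rule ccontr)
    assume "\<not> dpi Y X X' < 4 * xi"
    then have "between X Y = {}" using between_subset[of X Y X'] X assms ne by auto
    then show False using assms X by (simp add: PK_edge_def)
  qed
qed

text \<open>The last vertex before \<open>A\<close> on a standard path is adjacent to
  \<open>A\<close>, so it cannot also be adjacent to \<open>X\<close>.\<close>

lemma last_before:
  assumes "X \<in> YY" "A \<in> YY" "2 < nd X A"
  obtains D where "D \<in> between X A" "\<not> adj X D"
proof -
  have "X \<noteq> A" using assms by auto
  from standard_path[OF assms(1,2) this] obtain D where D: "adj D A" "D \<in> {X, A} \<union> between X A"
    using \<open>X \<noteq> A\<close> by (cases rule: rtranclp.cases) auto
  have "\<not> adj X D" 
  proof
    assume "adj X D"
    then have "nd X A \<le> 2" using nd_step[OF D(1) assms(1)] nd_edge[of X D] by simp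
    then show False using assms by simp
  qed
  moreover have "D \<noteq> X" using nd_edge[of X A] D assms by auto
  moreover have "D \<noteq> A" using D by (simp add: PK_edge_def)
  ultimately show ?thesis using D that by auto
qed

text \<open>Along a path far from \<open>A\<close>, choose for each vertex \<open>f i\<close> an element \<open>D i\<close> between \<open>f i\<close> and \<open>A\<close>
  on which the step \<open>f i\<close> to \<open>f (i + 1)\<close> is small. Consecutive \<open>D i\<close> are then comparable, and an element
  dominating all of them makes all \<open>f i\<close> look the same from \<open>A\<close>.\<close>

lemma far_path_small_projection:
  assumes A: "A \<in> YY" and f: "\<And>i. i < n \<Longrightarrow> adj (f i) (f (Suc i))" "f 0 \<in> YY"
    and far: "\<And>i. i \<le> n \<Longrightarrow> 2 < nd (f i) A"
  shows "dpi A (f 0) (f n) < 4 * xi"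
proof -
  have fY: "f i \<in> YY" if "i \<le> n" for i
  proof (cases i)
    case (Suc j)
    then show ?thesis using edge_in[OF f(1)[of j]] that by simp
  qed (use f(2) in simp)
  have fA: "f i \<noteq> A" if "i \<le> n" for i using far[OF that] by auto
  have "\<exists>d. d \<in> between (f i) A \<and> \<not> adj (f i) d" if "i \<le> n" for i
    using last_before[OF fY[OF that] A far[OF that]] by blast
  then have "\<exists>D. \<forall>i\<le>n. D i \<in> between (f i) A \<and> \<not> adj (f i) (D i)" by metis
  then obtain D where D: "\<And>i. i \<le> n \<Longrightarrow> D i \<in> between (f i) A" "\<And>i. i \<le> n \<Longrightarrow> \<not> adj (f i) (D i)" by blast
  have D': "D i \<in> YY" "D i \<noteq> A" "D i \<noteq> f i" "K < dpi (D i) (f i) A" if "i \<le> n" for i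
    using betweenD[OF fY[OF that] A D(1)[OF that]] by auto
  \<comment> \<open>One step of the path costs \<open>4 * xi\<close> and a comparison costs
    \<open>3 * xi\<close>, so consecutive \<open>D i\<close> are related with constant
    \<open>K - 7 * xi = b + 3 * xi\<close>. Two further comparisons give the levels \<open>b\<close>
    and \<open>b - 3 * xi\<close> of \<open>S\<close> and \<open>W\<close>.\<close>
  define b where "b = K - 10 * xi"
  have "\<exists>g\<in>{0..n}. \<forall>k\<in>{0..n}. (shields A b)\<^sup>=\<^sup>= (D g) (D k)"
  proof (rule chain_dominated[where R = "shields A (b + 3 * xi)" and W = "shields A (b - 3 * xi)" and n = n])
    show "shields A b x y" if "shields A (b + 3 * xi) x y" for x y
      using that xi_pos by (rule_tac shields_weaken) auto
    show "shields A (b - 3 * xi) x y" if "shields A b x y" for x y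
      using that xi_pos by (rule_tac shields_weaken) auto
    show "shields A b x z" if "shields A b x y" "shields A b y z" for x y z
      using shields_trans[OF that] K_large xi_pos by (auto simp: b_def)
    show "\<not> shields A (b - 3 * xi) y x" if "shields A (b - 3 * xi) x y" for x y
      using shields_asym[OF that] K_large xi_pos by (auto simp: b_def)
    show "g = h \<or> shields A b g h \<or> shields A (b - 3 * xi) h g" 
      if "shields A (b + 3 * xi) g e" "shields A b h e" for g h e
      using shields_compare[of A g h e "b + 3 * xi" b] shields_dpi that unfolding shields_def by auto
    show "D i = D (Suc i) \<or> shields A (b + 3 * xi) (D i) (D (Suc i)) \<or> shields A (b + 3 * xi) (D (Suc i)) (D i)"
      if "i < n" for i
    proof -
      have i: "i \<le> n" "Suc i \<le> n" using that by auto
      note small = step_small[OF f(1)[OF that] D'(1)[OF i(1)] D'(3)[OF i(1)] D(2)[OF i(1)]]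
      have "K - 4 * xi < dpi (D i) (f (Suc i)) A"
        using dpi_triangle[of "D i" "f i" "f (Suc i)" A] small D'[OF i(1)] fY[OF i(1)] fY[OF i(2)] fA[OF i(2)] A by auto
      then show ?thesis
        using shields_compare[of A "D i" "D (Suc i)" "f (Suc i)" "K - 4 * xi" K] 
          D'[OF i(1)] D'[OF i(2)] fY[OF i(2)] fA[OF i(2)] A small(1) 
          shields_weaken[of A "K - 3 * xi" "D (Suc i)" "D i" "b + 3 * xi"] xi_pos
        by (auto simp: b_def)
    qed
  qed auto
  then obtain g where g: "g \<le> n" "\<And>k. k \<le> n \<Longrightarrow> (shields A b)\<^sup>=\<^sup>= (D g) (D k)" by auto
  \<comment> \<open>One \<open>xi\<close> leads from \<open>f k\<close> to \<open>D k\<close>, the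
    other from \<open>D k\<close> to the dominating \<open>D g\<close>.\<close>
  have close: "dpi A (D g) (f k) < 2 * xi" if k: "k \<le> n" for k
  proof -
    have 1: "dpi A (D k) (f k) < xi"
      using dpi_small[of "f k" "D k" A] D'[OF k] A fY[OF k] fA[OF k] K_large xi_pos by auto
    show ?thesis
    proof (cases "D g = D k")
      case False
      then have "shields A b (D g) (D k)" using g(2)[OF k] by auto
      then have "dpi A (D g) (D k) < xi"
        using dpi_small[of "D k" "D g" A] shields_dpi[of A b "D g" "D k"] D'[OF k] D'[OF g(1)] A False K_large xi_pos 
        by (auto simp: b_def)
      then show ?thesis using 1 dpi_triangle[of A "D g" "D k" "f k"] D'[OF k] D'[OF g(1)] A fY[OF k] fA[OF k] by auto
    qed (use 1 xi_pos in auto)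
  qed
  show ?thesis
    using close[of 0] close[of n] dpi_triangle[of A "f 0" "D g" "f n"] dpi_sym[of A "f 0" "D g"]
      D'[OF g(1)] A fY[of 0] fY[of n] fA[of 0] fA[of n] by auto
qed

text \<open>A path staying farther than 2 from \<open>Y\<close> would have ends with
  \<open>4 * xi\<close>-close projections to \<open>Y\<close>, against
  \<open>Y \<in> between X Z\<close>. The set \<open>U\<close> is free so that the result serves
  different paths.\<close>

lemma barrier:
  assumes "(inside U)\<^sup>*\<^sup>* X Z" "X \<in> U" "X \<in> YY" "Z \<in> YY" "Y \<in> between X Z"
  obtains q where "q \<in> U" "q \<in> YY" "nd q Y \<le> 2"
proof -
  obtain n f where f: "f 0 = X" "f n = Z" "\<And>i. i < n \<Longrightarrow> inside U (f i) (f (Suc i))"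
    using rtranclp_imp_relpowp[OF assms(1)] unfolding relpowp_fun_conv by blast
  have fU: "f i \<in> U \<and> f i \<in> YY" if "i \<le> n" for i
  proof (cases i)
    case (Suc j)
    then show ?thesis using f(3)[of j] that edge_in[of "f j" "f i"] by simp
  qed (use f(1) assms(2,3) in simp)
  note Y = betweenD[OF assms(3,4,5)]
  have "\<exists>i\<le>n. nd (f i) Y \<le> 2"
  proof (rule ccontr)
    assume "\<not> ?thesis"
    then have "2 < nd (f i) Y" if "i \<le> n" for i using that by (meson not_le)
    then have "dpi Y (f 0) (f n) < 4 * xi"
      using f(3) fU[of 0] by (intro far_path_small_projection[OF Y(1)]) auto
    then show False using Y(6) f(1,2) by simp
  qed
  then show ?thesis using that fU by blast
qed

lemma equal_level_close:
  assumes "p \<in> YY" "x \<in> YY" "y \<in> YY" "nd p x = nd p y" "(inside {z \<in> YY. nd p x \<le> nd p z})\<^sup>*\<^sup>* x y"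
  shows "nd x y \<le> 13"
proof (cases "x = y")
  case False
  define S where "S = {x, y} \<union> between x y"
  have near: "nd x z \<le> 6 \<or> nd y z \<le> 6" if "z \<in> S" for z
  proof (cases "z \<in> {x, y}")
    case False
    with that have z: "z \<in> between x y" by (auto simp: S_def)
    have zY: "z \<in> YY" using betweenD[OF assms(2,3) z] by auto
    obtain q where "q \<in> YY" "nd p x \<le> nd p q" "nd q z \<le> 2"
      using barrier[OF assms(5) _ assms(2,3) z] assms(2) by auto
    then have level: "nd p x \<le> nd p z + 2" 
      using nd_triangle[of p z q] nd_sym[of q z] assms(1) zY by auto
    \<comment> \<open>\<open>U\<close> is the union of the metric intervals from \<open>p\<close> to
      \<open>x\<close> and to \<open>y\<close>. A point \<open>r\<close> of \<open>U\<close> within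
      2 of \<open>z\<close> has level at least \<open>nd p x - 4\<close>, hence is within 4 of
      \<open>x\<close> or \<open>y\<close>; this gives 6 for \<open>z\<close>.\<close>
    define U where "U = {u. nd x u + nd p u = nd p x} \<union> {u. nd y u + nd p u = nd p x}"
    have "(inside U)\<^sup>*\<^sup>* x p" "(inside U)\<^sup>*\<^sup>* y p"
      using inside_mono[OF geodesic[OF assms(1,2,2)], of U] inside_mono[OF geodesic[OF assms(1,3,3)], of U] assms(4)
      by (auto simp: U_def)
    then have "(inside U)\<^sup>*\<^sup>* x y" using inside_sym[of U y p] by auto
    then obtain r where r: "r \<in> U" "r \<in> YY" "nd r z \<le> 2"
      using barrier[OF _ _ assms(2,3) z, of U] by (auto simp: U_def)
    have "nd p z \<le> nd p r + 2" using nd_triangle[OF assms(1) r(2) zY] r(3) by simp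
    then have "nd x r \<le> 4 \<or> nd y r \<le> 4" using r(1) level by (auto simp: U_def)
    then show ?thesis 
      using nd_triangle[OF assms(2) r(2) zY] nd_triangle[OF assms(3) r(2) zY] r(3) by linarith
  qed auto
  \<comment> \<open>The first vertex of the standard path outside the 6-ball about \<open>x\<close>
    lies in the 6-ball about \<open>y\<close>, whence \<open>6 + 1 + 6\<close>.\<close>
  have "(inside S)\<^sup>*\<^sup>* x z \<Longrightarrow> nd x z \<le> 6 \<or> nd x y \<le> 13" for z
  proof (induction rule: rtranclp_induct)
    case (step v w)
    have vw: "v \<in> YY" "w \<in> YY" "nd x w \<le> nd x v + 1" using step(2) edge_in nd_step assms(2) by auto
    have "nd x y \<le> nd x w + nd y w" using nd_triangle[OF assms(2) vw(2) assms(3)] by (simp add: nd_sym)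
    then show ?case using step(2,3) near[of w] vw by auto
  qed simp
  from this[of y] show ?thesis using standard_path[OF assms(2,3) False] by (auto simp: S_def)
qed simp

end

theorem theorem2p9:
  fixes YY :: "'a set" and dpi :: "'a \<Rightarrow> 'a \<Rightarrow> 'a \<Rightarrow> real" and xi :: real
  assumes "proj_axioms YY dpi xi"
  shows "\<exists>K0. \<forall>K\<ge>K0. quasi_tree YY (PK_edge YY dpi xi K)"
proof (rule exI[of _ "20 * xi"], intro allI impI)
  fix K assume "20 * xi \<le> K"
  then interpret projection_complex YY dpi xi K
    by unfold_locales (use assms in auto)
  show "quasi_tree YY (PK_edge YY dpi xi K)"
  proof (cases "YY = {}")
    \<comment> \<open>There is no base point here; the empty graph counts as a tree.\<close>
    case True
    have "is_tree {} (\<lambda>_ _ :: 'a set. False)"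
      by (simp add: is_tree_def graph_connected_def walk_from_to_def walk_def)
    moreover have "quasi_isometric YY (gdist YY adj) {} (gdist {} (\<lambda>_ _ :: 'a set. False))"
      unfolding quasi_isometric_def using True
      by (intro exI[of _ "\<lambda>_. {}"] exI[of _ 1]) simp
    ultimately show ?thesis unfolding quasi_tree_def using graph_connected by blast
  next
    case False
    then obtain p where "p \<in> YY" by blast
    then show ?thesis by (rule bottleneck_quasi_tree) (rule equal_level_close[OF \<open>p \<in> YY\<close>])
  qed
qed

end
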